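(* Let $d\ge2$. There exists a constant $C_Q>0$ such that for all $k=k_0,k_1,k_2,k_3\in\mathbb R^d$ on the resonant manifold $$k+k_1=k_2+k_3,\qquad |k|^{1/2}+|k_1|^{1/2}=|k_2|^{1/2}+|k_3|^{1/2}$$ (at which the kernel is defined, i.e. all $k_j\neq0$ and no denominator vanishes), the collision kernel $T_{k,k_1,k_2,k_3}=|T_{k_1k}^{k_2k_3}|^2$ satisfies $$T_{k,k_1,k_2,k_3}\le C_Q\Big(\min_{0\le j<l\le3}\big(|k_j|^2+|k_l|^2\big)\Big)^2\Big(\sum_{j=0}^3|k_j|^2\Big).$$
   Context: With $f_\pm(x,y)=x\cdot y\pm|x||y|$ and $\omega_y=|y|^{1/2}$ for $y\in\mathbb R^d$, $\omega_i=|k_i|^{1/2}$, for vectors $k_1,\dots,k_4$ set $$\begin{aligned}\tilde T_{k_1k_2}^{k_3k_4}=&-\frac{1}{16\pi^2(|k_1||k_2||k_3||k_4|)^{1/4}}\Big\{-12|k_1||k_2||k_3||k_4|\\&-2(\omega_1+\omega_2)^2[\omega_3\omega_4f_-(k_1,k_2)+\omega_1\omega_2f_-(k_3,k_4)]\\&-2(\omega_1-\omega_3)^2[\omega_2\omega_4f_+(k_1,k_3)+\omega_1\omega_3f_+(k_2,k_4)]\\&-2(\omega_1-\omega_4)^2[\omega_2\omega_3f_+(k_1,k_4)+\omega_1\omega_4f_+(k_2,k_3)]\\&+f_+(k_1,k_2)f_+(k_3,k_4)+f_-(k_1,k_3)f_-(k_2,k_4)+f_-(k_1,k_4)f_-(k_2,k_3)\\&+\frac{4(\omega_1+\omega_2)^2f_-(k_1,k_2)f_-(k_3,k_4)}{\omega_{k_1+k_2}^2-(\omega_1+\omega_2)^2}+\frac{4(\omega_1-\omega_3)^2f_+(k_1,k_3)f_+(k_2,k_4)}{\omega_{k_1-k_3}^2-(\omega_1-\omega_3)^2}\\&+\frac{4(\omega_1-\omega_4)^2f_+(k_1,k_4)f_+(k_2,k_3)}{\omega_{k_1-k_4}^2-(\omega_1-\omega_4)^2}\Big\}.\end{aligned}$$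 For other arguments $\tilde T_{pq}^{rs}$ denotes the same expression with $(k_1,k_2,k_3,k_4)$ replaced by $(p,q,r,s)$. Then $$T_{k_1k}^{k_2k_3}=\tfrac14\big(\tilde T_{k_1k}^{k_2k_3}+\tilde T_{kk_1}^{k_2k_3}+\tilde T_{k_2k_3}^{k_1k}+\tilde T_{k_3k_2}^{k_1k}\big).$$ *)

theory Defs
  imports "HOL-Analysis.Analysis"
begin

definition f_plus :: "'a::real_inner \<Rightarrow> 'a \<Rightarrow> real" where
  "f_plus x y = x \<bullet> y + norm x * norm y"

definition f_minus :: "'a::real_inner \<Rightarrow> 'a \<Rightarrow> real" where
  "f_minus x y = x \<bullet> y - norm x * norm y"

definition omega :: "'a::real_inner \<Rightarrow> real" where
  "omega y = norm y powr (1/2)"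

text \<open>\<open>T_tilde p q r s\<close> is $\tilde T_{pq}^{rs}$: the first two arguments are the lower
  indices, the last two the upper ones.\<close>

definition T_tilde :: "'a::real_inner \<Rightarrow> 'a \<Rightarrow> 'a \<Rightarrow> 'a \<Rightarrow> real" where
  "T_tilde k1 k2 k3 k4 =
    - (1 / (16 * pi\<^sup>2 * (norm k1 * norm k2 * norm k3 * norm k4) powr (1/4))) *
    ( - 12 * norm k1 * norm k2 * norm k3 * norm k4
      - 2 * (omega k1 + omega k2)\<^sup>2 *
          (omega k3 * omega k4 * f_minus k1 k2 + omega k1 * omega k2 * f_minus k3 k4)
      - 2 * (omega k1 - omega k3)\<^sup>2 *
          (omega k2 * omega k4 * f_plus k1 k3 + omega k1 * omega k3 * f_plus k2 k4)
      - 2 * (omega k1 - omega k4)\<^sup>2 *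
          (omega k2 * omega k3 * f_plus k1 k4 + omega k1 * omega k4 * f_plus k2 k3)
      + f_plus k1 k2 * f_plus k3 k4
      + f_minus k1 k3 * f_minus k2 k4
      + f_minus k1 k4 * f_minus k2 k3
      + 4 * (omega k1 + omega k2)\<^sup>2 * f_minus k1 k2 * f_minus k3 k4
          / ((omega (k1 + k2))\<^sup>2 - (omega k1 + omega k2)\<^sup>2)
      + 4 * (omega k1 - omega k3)\<^sup>2 * f_plus k1 k3 * f_plus k2 k4
          / ((omega (k1 - k3))\<^sup>2 - (omega k1 - omega k3)\<^sup>2)
      + 4 * (omega k1 - omega k4)\<^sup>2 * f_plus k1 k4 * f_plus k2 k3
          / ((omega (k1 - k4))\<^sup>2 - (omega k1 - omega k4)\<^sup>2))"

text \<open>Division by zero is total in HOL, so the points at which the expression for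
  $\tilde T$ makes sense are singled out explicitly.\<close>

definition T_tilde_defined :: "'a::real_inner \<Rightarrow> 'a \<Rightarrow> 'a \<Rightarrow> 'a \<Rightarrow> bool" where
  "T_tilde_defined k1 k2 k3 k4 \<longleftrightarrow>
    k1 \<noteq> 0 \<and> k2 \<noteq> 0 \<and> k3 \<noteq> 0 \<and> k4 \<noteq> 0 \<and>
    (omega (k1 + k2))\<^sup>2 - (omega k1 + omega k2)\<^sup>2 \<noteq> 0 \<and>
    (omega (k1 - k3))\<^sup>2 - (omega k1 - omega k3)\<^sup>2 \<noteq> 0 \<and>
    (omega (k1 - k4))\<^sup>2 - (omega k1 - omega k4)\<^sup>2 \<noteq> 0"

text \<open>\<open>T_sym k1 k k2 k3\<close> is $T_{k_1k}^{k_2k_3}$; note the order of the two lower indices.\<close>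

definition T_sym :: "'a::real_inner \<Rightarrow> 'a \<Rightarrow> 'a \<Rightarrow> 'a \<Rightarrow> real" where
  "T_sym k1 k k2 k3 =
    1/4 * (T_tilde k1 k k2 k3 + T_tilde k k1 k2 k3 + T_tilde k2 k3 k1 k + T_tilde k3 k2 k1 k)"

definition T_sym_defined :: "'a::real_inner \<Rightarrow> 'a \<Rightarrow> 'a \<Rightarrow> 'a \<Rightarrow> bool" where
  "T_sym_defined k1 k k2 k3 \<longleftrightarrow>
    T_tilde_defined k1 k k2 k3 \<and> T_tilde_defined k k1 k2 k3 \<and>
    T_tilde_defined k2 k3 k1 k \<and> T_tilde_defined k3 k2 k1 k"

definition collision_kernel :: "'a::real_inner \<Rightarrow> 'a \<Rightarrow> 'a \<Rightarrow> 'a \<Rightarrow> real" where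
  "collision_kernel k k1 k2 k3 = \<bar>T_sym k1 k k2 k3\<bar>\<^sup>2"

definition resonant :: "'a::real_inner \<Rightarrow> 'a \<Rightarrow> 'a \<Rightarrow> 'a \<Rightarrow> bool" where
  "resonant k k1 k2 k3 \<longleftrightarrow>
    k + k1 = k2 + k3 \<and>
    norm k powr (1/2) + norm k1 powr (1/2) = norm k2 powr (1/2) + norm k3 powr (1/2)"

end

theory Submission
  imports Defs
begin

text \<open>On the resonant manifold \<open>T_tilde\<close> is invariant under swapping the lower indices, the upper
  indices, and the two levels, so the symmetrized kernel is a single \<open>T_tilde p q r s\<close> and one may
  assume \<open>\<omega>\<^sub>q \<le> \<omega>\<^sub>s \<le> \<omega>\<^sub>r \<le> \<omega>\<^sub>p\<close>. Then \<open>norm s\<close> is the second smallest norm, and the claim is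
  \<open>\<bar>T_tilde p q r s\<bar> = O((norm s)\<^sup>2 * norm p)\<close>; by homogeneity \<open>\<omega>\<^sub>p + \<omega>\<^sub>r = 2\<close>.

  Every term of the bracket is \<open>O(\<omega>\<^sub>q)\<close>, which suffices unless \<open>t = (\<omega>\<^sub>q + \<omega>\<^sub>s) / 2\<close> is small.
  If \<open>t\<close> is small, momentum conservation forces \<open>\<omega>\<^sub>s - \<omega>\<^sub>q = \<omega>\<^sub>p - \<omega>\<^sub>r = O(t\<^sup>2)\<close>. The single terms of
  the bracket are only \<open>O(t\<^sup>3)\<close>, but the contributions of orders \<open>t\<^sup>3\<close> and \<open>t\<^sup>4\<close> cancel, and the
  resulting bound \<open>O(t\<^sup>5)\<close> is exactly what is needed.\<close>

section \<open>Elementary facts\<close>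

lemma omega_nonneg [simp]: "omega y \<ge> 0"
  by (simp add: omega_def)

lemma omega_pos: "y \<noteq> 0 \<Longrightarrow> omega y > 0"
  by (simp add: omega_def)

lemma norm_eq_omega: "norm y = (omega y)\<^sup>2"
  by (simp add: omega_def powr_half_sqrt)

lemma f_plus_commute: "f_plus x y = f_plus y x"
  by (simp add: f_plus_def inner_commute mult.commute)

lemma f_minus_commute: "f_minus x y = f_minus y x"
  by (simp add: f_minus_def inner_commute mult.commute)

lemma f_plus_conv_f_minus: "f_plus x y = f_minus x y + 2 * (norm x * norm y)"
  by (simp add: f_plus_def f_minus_def)

lemma abs_f_plus_le: "\<bar>f_plus x y\<bar> \<le> 2 * (norm x * norm y)"
  using Cauchy_Schwarz_ineq2[of x y] by (simp add: f_plus_def abs_le_iff)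

lemma abs_f_minus_le: "\<bar>f_minus x y\<bar> \<le> 2 * (norm x * norm y)"
  using Cauchy_Schwarz_ineq2[of x y] by (simp add: f_minus_def abs_le_iff)

lemma norm_add_sq: "(norm (x + y))\<^sup>2 = (norm x + norm y)\<^sup>2 + 2 * f_minus x y"
  by (simp add: f_minus_def power2_norm_eq_inner inner_simps inner_commute power2_sum)

lemma norm_diff_sq: "(norm (x - y))\<^sup>2 = (norm x + norm y)\<^sup>2 - 2 * f_plus x y"
  by (simp add: f_plus_def power2_norm_eq_inner inner_simps inner_commute power2_sum)

lemma norm_diff_sq': "(norm (x - y))\<^sup>2 = (norm x - norm y)\<^sup>2 - 2 * f_minus x y"
  by (simp add: f_minus_def power2_norm_eq_inner inner_simps inner_commute power2_diff)

lemma abs_mult_le: "\<bar>x\<bar> \<le> X \<Longrightarrow> \<bar>y\<bar> \<le> Y \<Longrightarrow> \<bar>x * y\<bar> \<le> X * Y" for x y X Y :: real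
  by (simp add: abs_mult mult_mono')

lemma abs_add_le: "\<bar>x\<bar> \<le> X \<Longrightarrow> \<bar>y\<bar> \<le> Y \<Longrightarrow> \<bar>x + y\<bar> \<le> X + Y" for x y X Y :: real
  by linarith

lemma abs_sum6_le:
  fixes x0 :: real
  assumes "\<bar>x0\<bar> \<le> X0" "\<bar>x1\<bar> \<le> X1" "\<bar>x2\<bar> \<le> X2" "\<bar>x3\<bar> \<le> X3" "\<bar>x4\<bar> \<le> X4" "\<bar>x5\<bar> \<le> X5"
  shows "\<bar>x0 - x1 - x2 - x3 + x4 + x5\<bar> \<le> X0 + X1 + X2 + X3 + X4 + X5"
  using assms unfolding abs_le_iff by linarith

lemma abs_sum10_le:
  fixes x0 :: real
  assumes "\<bar>x0\<bar> \<le> X0" "\<bar>x1\<bar> \<le> X1" "\<bar>x2\<bar> \<le> X2" "\<bar>x3\<bar> \<le> X3" "\<bar>x4\<bar> \<le> X4"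
    "\<bar>x5\<bar> \<le> X5" "\<bar>x6\<bar> \<le> X6" "\<bar>x7\<bar> \<le> X7" "\<bar>x8\<bar> \<le> X8" "\<bar>x9\<bar> \<le> X9"
  shows "\<bar>- x0 - x1 - x2 - x3 + x4 + x5 + x6 + x7 + x8 + x9\<bar>
    \<le> X0 + X1 + X2 + X3 + X4 + X5 + X6 + X7 + X8 + X9"
  using assms unfolding abs_le_iff by linarith

text \<open>No bound for \<open>1 / D\<close> by itself is available: one factor \<open>w\<close> of
  the numerator and the factor \<open>m\<close> in the bound for \<open>f\<close> are cancelled
  against \<open>D\<close>. If \<open>w = 0\<close>, \<open>D\<close> may vanish, but then the
  numerator is zero as well.\<close>

lemma abs_quotient_le:
  fixes D m w w' f g F G :: real
  assumes "m > 0" "w \<ge> 0" "2 * (m * w) \<le> \<bar>D\<bar>" "\<bar>f\<bar> \<le> m * F" "\<bar>g\<bar> \<le> G"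
  shows "\<bar>4 * (w * w') * f * g / D\<bar> \<le> 2 * \<bar>w'\<bar> * F * G"
proof (cases "w = 0")
  case True
  have "F \<ge> 0" using assms(1,4) by (smt (verit) mult_pos_neg)
  then show ?thesis using True assms(5) by simp
next
  case False
  then have "m * w > 0" using assms by simp
  then have D: "\<bar>D\<bar> > 0" using assms(3) by linarith
  have FG: "F \<ge> 0" "G \<ge> 0" using assms(1,4,5) by (smt (verit) mult_pos_neg)+
  have "\<bar>4 * (w * w') * f * g\<bar> = 4 * (w * \<bar>w'\<bar>) * (\<bar>f\<bar> * \<bar>g\<bar>)"
    using assms by (simp add: abs_mult)
  also have "\<dots> \<le> 4 * (w * \<bar>w'\<bar>) * ((m * F) * G)"
    using assms by (intro mult_left_mono mult_mono) auto
  also have "\<dots> = (2 * \<bar>w'\<bar> * F * G) * (2 * (m * w))"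
    by simp
  also have "\<dots> \<le> (2 * \<bar>w'\<bar> * F * G) * \<bar>D\<bar>"
    using assms FG by (intro mult_left_mono) auto
  finally show ?thesis
    using D by (simp add: abs_divide pos_divide_le_eq)
qed

text \<open>Multiplying by \<open>P + S\<close> removes the square root hidden in
  \<open>P = norm (p + q)\<close>: \<open>z\<close> is polynomial in inner products and frequencies.
  The remaining factor \<open>4 * S / (P + S)\<close> is 2 up to a term with the small factor
  \<open>P - S\<close>.\<close>

lemma quotient_expansion:
  fixes P S x y z :: real
  assumes "z = (P\<^sup>2 - S\<^sup>2) / 2" "P \<noteq> S" "P + S \<noteq> 0"
  shows "4 * S * x * y / (P - S) = 4 * S\<^sup>2 * x * y / z + 2 * x * y - 2 * x * y * (P - S) / (P + S)"
proof -
  have z: "z = (P - S) * (P + S) / 2"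
    using assms(1) by (simp add: power2_eq_square algebra_simps)
  have "P - S \<noteq> 0" using assms by simp
  then show ?thesis
    unfolding z using assms(3) by (simp add: divide_simps power2_eq_square) (simp add: algebra_simps)
qed

section \<open>The cancellation of the leading orders\<close>

text \<open>The quotient by \<open>t^7\<close> of the polynomial in the lemma \<open>cancellation\<close>, obtained by expanding it.
  Its coefficients are irrelevant: all that matters is that it is a polynomial.\<close>

definition remainder :: "real \<Rightarrow> real \<Rightarrow> real \<Rightarrow> real \<Rightarrow> real" where
  "remainder t g u v =
      - 32 * u * v + 96 * g * u - 6 * t + 72 * t * v + 12 * t * u^2 - 8 * t * u^2 * v
      - 6 * t * u^4 - 104 * t * g - 32 * t * g * v + 72 * t * g * u^2 - 48 * t^2 * u
      + 32 * t^2 * u * v + 48 * t^2 * u^3 - 64 * t^2 * g * u + 48 * t^3 - 32 * t^3 * v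
      - 144 * t^3 * u^2 - 64 * t^3 * u^2 * v - 48 * t^3 * g + 16 * t^3 * g * v
      + 304 * t^3 * g * u^2 + 16 * t^3 * g^2 + 192 * t^4 * u + 256 * t^4 * u * v
      - 48 * t^4 * u * v^2 - 736 * t^4 * g * u + 128 * t^4 * g * u * v + 32 * t^4 * g * u^3
      + 80 * t^4 * g^2 * u - 96 * t^5 - 248 * t^5 * v + 120 * t^5 * v^2 + 8 * t^5 * v^3
      - 8 * t^5 * u^2 * v + 368 * t^5 * g - 64 * t^5 * g * v - 72 * t^5 * g * v^2
      + 112 * t^5 * g * u^2 + 32 * t^5 * g * u^2 * v + 444 * t^5 * g^2 + 36 * t^5 * g^2 * u^2
      - 48 * t^6 * u * v^2 - 608 * t^6 * g * u + 320 * t^6 * g * u * v + 384 * t^6 * g^2 * u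
      + 32 * t^7 * v + 96 * t^7 * v^2 - 8 * t^7 * v^3 + 600 * t^7 * g - 576 * t^7 * g * v
      + 16 * t^7 * g * v^2 + 72 * t^7 * g * u^2 + 32 * t^7 * g * u^2 * v - 1152 * t^7 * g^2
      + 88 * t^7 * g^2 * v + 144 * t^7 * g^2 * u^2 + 224 * t^7 * g^3 - 192 * t^8 * g * u
      - 32 * t^8 * g * u * v^2 - 48 * t^8 * g^2 * u + 64 * t^8 * g^2 * u * v
      + 96 * t^8 * g^3 * u + 8 * t^9 * v^3 + 6 * t^9 * v^4 + 96 * t^9 * g - 112 * t^9 * g * v
      + 80 * t^9 * g * v^2 - 32 * t^9 * g * v^3 + 124 * t^9 * g^2 + 592 * t^9 * g^2 * v
      - 36 * t^9 * g^2 * v^2 + 36 * t^9 * g^2 * u^2 + 16 * t^9 * g^2 * u^2 * v + 40 * t^9 * g^3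
      - 8 * t^9 * g^3 * u^2 - 64 * t^10 * g^2 * u + 736 * t^10 * g^3 * u - 32 * t^11 * g * v
      - 72 * t^11 * g * v^2 - 32 * t^11 * g * v^3 + 24 * t^11 * g^2 * v - 48 * t^11 * g^2 * v^2
      - 1208 * t^11 * g^3 + 464 * t^11 * g^3 * v - 8 * t^11 * g^3 * u^2 + 144 * t^11 * g^4
      + 128 * t^12 * g^3 * u + 112 * t^12 * g^4 * u - 36 * t^13 * g^2 * v^2
      - 16 * t^13 * g^2 * v^3 + 464 * t^13 * g^3 * v + 8 * t^13 * g^3 * v^2 - 284 * t^13 * g^4
      + 32 * t^13 * g^4 * v - 4 * t^13 * g^4 * u^2 + 128 * t^14 * g^4 * u + 8 * t^15 * g^3 * v^2
      - 96 * t^15 * g^4 + 168 * t^15 * g^4 * v + 32 * t^17 * g^4 * v + 4 * t^17 * g^4 * v^2"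

text \<open>The frequencies of \<open>p, q, r, s\<close> are \<open>1 + h, t - h, 1 - h, t + h\<close>, and \<open>x\<close>, \<open>y\<close>, \<open>-x'\<close>, \<open>-y'\<close> are
  \<open>f_minus p q\<close>, \<open>f_minus r s\<close>, \<open>f_plus p s\<close>, \<open>f_plus q r\<close>. The primed quantities arise from the
  unprimed ones by replacing \<open>q, s, \<omega>\<^sub>q, \<omega>\<^sub>s\<close> with \<open>-s, -q, -\<omega>\<^sub>s, -\<omega>\<^sub>q\<close>, which maps the two resonance
  conditions to themselves. Since \<open>z\<close> and \<open>z'\<close> are of order \<open>t\<close>, the factor \<open>t^7\<close> means \<open>t^5\<close> after
  division by \<open>z * z'\<close>.\<close>

lemma cancellation:
  fixes t d u v :: real
  assumes "h = t^2*d" "S = (1+t)^2" "S' = (1-t)^2"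
    "A = (1+h)*(t-h)" "B = (1-h)*(t+h)" "A' = -((1+h)*(t+h))" "B' = -((1-h)*(t-h))"
    "z = (-3*t^2 + t^4 * v) - (2*t+t^2*u)" "z' = (-3*t^2 + t^4 * v) + (2*t+t^2*u)"
    "x = z + 2*A*(S-A)" "y = z + 2*B*(S-B)" "x' = z' + 2*A'*(S'-A')" "y' = z' + 2*B'*(S'-B')"
  shows "(-2*S*(B*x+A*y) + (x+2*A^2)*(y+2*B^2) + 2*x*y
      - 2*S'*(B'*x'+A'*y') + (x'+2*A'^2)*(y'+2*B'^2) + 2*x'*y' - 12*A^2*B^2)*z*z'
      + 4*S^2*x*y*z' + 4*S'^2*x'*y'*z = t^7 * remainder t (d^2) u v"
  unfolding assms(10-) assms(9,8,7,6,5,4,3,2,1) remainder_def by algebra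

text \<open>Compactness of a cube replaces any estimate of the individual coefficients.\<close>

lemma remainder_bounded:
  "\<exists>C>0. \<forall>t g u v. \<bar>t\<bar> \<le> K \<and> \<bar>g\<bar> \<le> K \<and> \<bar>u\<bar> \<le> K \<and> \<bar>v\<bar> \<le> K \<longrightarrow> \<bar>remainder t g u v\<bar> \<le> C"
proof -
  define f where "f = (\<lambda>(t, g, u, v). remainder t g u v)"
  have "continuous_on ({-K..K} \<times> {-K..K} \<times> {-K..K} \<times> {-K..K}) f"
    unfolding f_def remainder_def case_prod_unfold by (intro continuous_intros)
  then have "compact (f ` ({-K..K} \<times> {-K..K} \<times> {-K..K} \<times> {-K..K}))"
    by (intro compact_continuous_image compact_Times compact_Icc)
  then obtain C where "C > 0" "\<forall>w\<in>f ` ({-K..K} \<times> {-K..K} \<times> {-K..K} \<times> {-K..K}). \<bar>w\<bar> \<le> C"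
    by (metis bounded_pos compact_imp_bounded real_norm_def)
  then show ?thesis
    by (intro exI[of _ C]) (force simp: f_def abs_le_iff)
qed

section \<open>Bounds on the bracket\<close>

text \<open>The braces in \<open>T_tilde\<close>, split off because the prefactor blows up at small
  frequencies and is estimated separately in \<open>abs_T_tilde_le\<close>.\<close>

definition bracket :: "'a::real_inner \<Rightarrow> 'a \<Rightarrow> 'a \<Rightarrow> 'a \<Rightarrow> real" where
  "bracket k1 k2 k3 k4 =
      - 12 * norm k1 * norm k2 * norm k3 * norm k4
      - 2 * (omega k1 + omega k2)\<^sup>2 *
          (omega k3 * omega k4 * f_minus k1 k2 + omega k1 * omega k2 * f_minus k3 k4)
      - 2 * (omega k1 - omega k3)\<^sup>2 *
          (omega k2 * omega k4 * f_plus k1 k3 + omega k1 * omega k3 * f_plus k2 k4)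
      - 2 * (omega k1 - omega k4)\<^sup>2 *
          (omega k2 * omega k3 * f_plus k1 k4 + omega k1 * omega k4 * f_plus k2 k3)
      + f_plus k1 k2 * f_plus k3 k4
      + f_minus k1 k3 * f_minus k2 k4
      + f_minus k1 k4 * f_minus k2 k3
      + 4 * (omega k1 + omega k2)\<^sup>2 * f_minus k1 k2 * f_minus k3 k4
          / ((omega (k1 + k2))\<^sup>2 - (omega k1 + omega k2)\<^sup>2)
      + 4 * (omega k1 - omega k3)\<^sup>2 * f_plus k1 k3 * f_plus k2 k4
          / ((omega (k1 - k3))\<^sup>2 - (omega k1 - omega k3)\<^sup>2)
      + 4 * (omega k1 - omega k4)\<^sup>2 * f_plus k1 k4 * f_plus k2 k3
          / ((omega (k1 - k4))\<^sup>2 - (omega k1 - omega k4)\<^sup>2)"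

lemma T_tilde_eq:
  "T_tilde p q r s =
     - (bracket p q r s / (16 * pi\<^sup>2 * sqrt (omega p * omega q * omega r * omega s)))"
proof -
  have "norm p * norm q * norm r * norm s = (omega p * omega q * omega r * omega s)\<^sup>2"
    by (simp add: norm_eq_omega power_mult_distrib)
  moreover have "(x\<^sup>2) powr (1/4) = sqrt x" if "x \<ge> 0" for x :: real
    using that by (simp add: powr_half_sqrt[symmetric] powr_powr flip: powr_numeral)
  ultimately show ?thesis
    by (simp add: T_tilde_def bracket_def)
qed

lemma abs_T_tilde_le:
  assumes "0 < m" "m\<^sup>2 \<le> omega p * omega q * omega r * omega s"
  shows "\<bar>T_tilde p q r s\<bar> \<le> \<bar>bracket p q r s\<bar> / m"
proof -
  have "m \<le> sqrt (omega p * omega q * omega r * omega s)"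
    using assms by (simp add: real_le_rsqrt)
  moreover have "1 \<le> 16 * pi\<^sup>2"
    using one_le_power[of pi 2] pi_gt3 by linarith
  ultimately have "1 * m \<le> 16 * pi\<^sup>2 * sqrt (omega p * omega q * omega r * omega s)"
    using assms by (intro mult_mono) auto
  then show ?thesis
    using assms by (auto simp: T_tilde_eq abs_mult intro!: divide_left_mono)
qed

section \<open>Denominators, and the bound by the smallest frequency\<close>

lemma denominator_plus_le:
  "(omega (x + y))\<^sup>2 - (omega x + omega y)\<^sup>2 \<le> - (2 * (omega x * omega y))"
  using norm_triangle_ineq[of x y] by (simp add: norm_eq_omega power2_sum)

text \<open>By the reverse triangle inequality the denominator vanishes at most linearly in
  \<open>omega x - omega y\<close>, while the numerators in \<open>bracket\<close> vanish
  quadratically.\<close>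

lemma denominator_minus_ge:
  assumes "omega y \<le> omega x"
  shows "2 * (omega y * (omega x - omega y)) \<le> (omega (x - y))\<^sup>2 - (omega x - omega y)\<^sup>2"
  using norm_triangle_ineq2[of x y] by (simp add: norm_eq_omega power2_eq_square algebra_simps)


text \<open>Every summand contains a factor \<open>norm q\<close>, \<open>omega q\<close>, or an
  \<open>f_plus\<close> or \<open>f_minus\<close> with argument \<open>q\<close>, which is
  \<open>O(norm q)\<close> by Cauchy-Schwarz. The ten bounds add up to 27648 times
  \<open>omega q\<close>.\<close>

lemma bracket_le_smallest:
  fixes p q r s :: "'a::real_inner"
  assumes "omega p \<le> 2" "omega q \<le> omega s" "omega s \<le> omega r" "omega r \<le> omega p"
    and q: "0 < omega q"
  shows "\<bar>bracket p q r s\<bar> \<le> 30000 * omega q"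
proof -
  define a b c e where abce: "a = omega p" "b = omega q" "c = omega r" "e = omega s"
  have o: "0 < a" "0 < b" "0 < c" "0 < e" "a \<le> 2" "b \<le> 2" "c \<le> 2" "e \<le> 2"
    "b \<le> e" "e \<le> c" "c \<le> a"
    using assms unfolding abce by auto
  have n: "norm p = a\<^sup>2" "norm q = b\<^sup>2" "norm r = c\<^sup>2" "norm s = e\<^sup>2"
    by (simp_all add: norm_eq_omega abce)
  have sq4: "x\<^sup>2 \<le> 4" if "0 < x" "x \<le> 2" for x :: real
    using power_mono[of x 2 2] that by simp
  have n4: "norm p \<le> 4" "norm r \<le> 4" "norm s \<le> 4" "norm q \<le> 2 * b"
    unfolding n using o sq4 by (auto simp: power2_eq_square)
  have f: "\<bar>f_plus k l\<bar> \<le> 32" "\<bar>f_minus k l\<bar> \<le> 32"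
    if "norm k \<le> 4" "norm l \<le> 4" for k l :: 'a
    using abs_f_plus_le[of k l] abs_f_minus_le[of k l] mult_mono[OF that] by auto
  have fq: "\<bar>f_plus k q\<bar> \<le> 16 * b" "\<bar>f_minus k q\<bar> \<le> 16 * b"
    "\<bar>f_plus q k\<bar> \<le> 16 * b" "\<bar>f_minus q k\<bar> \<le> 16 * b" if "norm k \<le> 4" for k :: 'a
    using abs_f_plus_le[of k q] abs_f_minus_le[of k q] mult_mono[OF that n4(4)] o
    by (auto simp: f_plus_commute[of q k] f_minus_commute[of q k])
  have w: "\<bar>a\<bar> \<le> 2" "\<bar>b\<bar> \<le> b" "\<bar>c\<bar> \<le> 2" "\<bar>e\<bar> \<le> 2" "\<bar>2\<bar> \<le> (2::real)" "\<bar>12\<bar> \<le> (12::real)"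
    "\<bar>norm p\<bar> \<le> 4" "\<bar>norm q\<bar> \<le> 2 * b" "\<bar>norm r\<bar> \<le> 4" "\<bar>norm s\<bar> \<le> 4"
    using o n4 by auto
  have w2: "\<bar>(a + b)\<^sup>2\<bar> \<le> 16" "\<bar>(a - c)\<^sup>2\<bar> \<le> 16" "\<bar>(a - e)\<^sup>2\<bar> \<le> 16"
    using power_mono[of "a + b" 4 2] power_mono[of "a - c" 4 2] power_mono[of "a - e" 4 2] o by auto
  note bounds = abs_mult_le abs_add_le w w2 f fq n4
  have t0: "\<bar>12 * norm p * norm q * norm r * norm s\<bar> \<le> 12 * 4 * (2 * b) * 4 * 4"
    by (intro bounds)
  have t1: "\<bar>2 * (a + b)\<^sup>2 * (c * e * f_minus p q + a * b * f_minus r s)\<bar>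
      \<le> 2 * 16 * (2 * 2 * (16 * b) + 2 * b * 32)"
    by (intro bounds)
  have t2: "\<bar>2 * (a - c)\<^sup>2 * (b * e * f_plus p r + a * c * f_plus q s)\<bar>
      \<le> 2 * 16 * (b * 2 * 32 + 2 * 2 * (16 * b))"
    by (intro bounds)
  have t3: "\<bar>2 * (a - e)\<^sup>2 * (b * c * f_plus p s + a * e * f_plus q r)\<bar>
      \<le> 2 * 16 * (b * 2 * 32 + 2 * 2 * (16 * b))"
    by (intro bounds)
  have t4: "\<bar>f_plus p q * f_plus r s\<bar> \<le> 16 * b * 32" by (intro bounds)
  have t5: "\<bar>f_minus p r * f_minus q s\<bar> \<le> 32 * (16 * b)" by (intro bounds)
  have t6: "\<bar>f_minus p s * f_minus q r\<bar> \<le> 32 * (16 * b)" by (intro bounds)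
  have t7: "\<bar>4 * (a + b)\<^sup>2 * f_minus p q * f_minus r s / ((omega (p + q))\<^sup>2 - (a + b)\<^sup>2)\<bar> \<le> 4096 * b"
  proof -
    \<comment> \<open>Here \<open>m = a * b\<close> and \<open>w = 1\<close>: one factor
      \<open>a * b\<close> of the bound for \<open>f_minus p q\<close> cancels the denominator, the
      other supplies \<open>omega q\<close>.\<close>
    have "\<bar>4 * (1 * (a + b)\<^sup>2) * f_minus p q * f_minus r s / ((omega (p + q))\<^sup>2 - (a + b)\<^sup>2)\<bar>
        \<le> 2 * \<bar>(a + b)\<^sup>2\<bar> * (2 * (a * b)) * 32"
    proof (rule abs_quotient_le)
      show "2 * (a * b * 1) \<le> \<bar>(omega (p + q))\<^sup>2 - (a + b)\<^sup>2\<bar>"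
        using denominator_plus_le[of p q] by (simp add: abce)
      show "\<bar>f_minus p q\<bar> \<le> a * b * (2 * (a * b))"
        using abs_f_minus_le[of p q] by (simp add: n power2_eq_square mult_ac)
    qed (use o f n4 in auto)
    also have "\<dots> \<le> 2 * 16 * (2 * (2 * b)) * 32"
      using w2 o by (intro mult_mono mult_left_mono) auto
    finally show ?thesis by simp
  qed
  have t8: "\<bar>4 * (a - c)\<^sup>2 * f_plus p r * f_plus q s / ((omega (p - r))\<^sup>2 - (a - c)\<^sup>2)\<bar> \<le> 4096 * b"
  proof -
    \<comment> \<open>Here \<open>m = c\<close> and \<open>w = w' = a - c\<close>; the factor
      \<open>omega q\<close> comes from \<open>f_plus q s\<close>.\<close>
    have "\<bar>4 * ((a - c) * (a - c)) * f_plus p r * f_plus q s / ((omega (p - r))\<^sup>2 - (a - c)\<^sup>2)\<bar>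
        \<le> 2 * \<bar>a - c\<bar> * (2 * (a\<^sup>2 * c)) * (16 * b)"
    proof (rule abs_quotient_le)
      show "2 * (c * (a - c)) \<le> \<bar>(omega (p - r))\<^sup>2 - (a - c)\<^sup>2\<bar>"
        using denominator_minus_ge[of r p] o by (simp add: abce)
      show "\<bar>f_plus p r\<bar> \<le> c * (2 * (a\<^sup>2 * c))"
        using abs_f_plus_le[of p r] by (simp add: n power2_eq_square mult_ac)
    qed (use o fq n4 in auto)
    also have "\<dots> \<le> 2 * 2 * (2 * (4 * 2)) * (16 * b)"
      using o sq4 by (intro mult_mono mult_left_mono) auto
    finally show ?thesis using o by (simp add: power2_eq_square)
  qed
  have t9: "\<bar>4 * (a - e)\<^sup>2 * f_plus p s * f_plus q r / ((omega (p - s))\<^sup>2 - (a - e)\<^sup>2)\<bar> \<le> 4096 * b"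
  proof -
    have "\<bar>4 * ((a - e) * (a - e)) * f_plus p s * f_plus q r / ((omega (p - s))\<^sup>2 - (a - e)\<^sup>2)\<bar>
        \<le> 2 * \<bar>a - e\<bar> * (2 * (a\<^sup>2 * e)) * (16 * b)"
    proof (rule abs_quotient_le)
      show "2 * (e * (a - e)) \<le> \<bar>(omega (p - s))\<^sup>2 - (a - e)\<^sup>2\<bar>"
        using denominator_minus_ge[of s p] o by (simp add: abce)
      show "\<bar>f_plus p s\<bar> \<le> e * (2 * (a\<^sup>2 * e))"
        using abs_f_plus_le[of p s] by (simp add: n power2_eq_square mult_ac)
    qed (use o fq n4 in auto)
    also have "\<dots> \<le> 2 * 2 * (2 * (4 * 2)) * (16 * b)"
      using o sq4 by (intro mult_mono mult_left_mono) auto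
    finally show ?thesis using o by (simp add: power2_eq_square)
  qed
  show ?thesis
    unfolding bracket_def abce[symmetric] mult_minus_left
    by (rule order_trans[OF abs_sum10_le[OF t0 t1 t2 t3 t4 t5 t6 t7 t8 t9]])
      (use o in simp)
qed


section \<open>The regime of two long waves\<close>

text \<open>The summands are grouped by channel. Those of \<open>p + q\<close> and
  \<open>p - s\<close> have a main part \<open>M\<close> with \<open>M * (z * z') = O(t^7)\<close>
  by \<open>cancellation\<close>, and \<open>z * z'\<close> is of order \<open>t^2\<close>. Those of
  \<open>p - r\<close> are \<open>O(t^6)\<close>, because \<open>omega p - omega r = 2 * h\<close>
  and \<open>norm (p - r)\<close> are \<open>O(t^2)\<close>.\<close>

lemma bracket_le_long_waves:
  "\<exists>C>0. \<forall>(p::'a::real_inner) q r s t h.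
     p + q = r + s \<longrightarrow> omega p = 1 + h \<longrightarrow> omega r = 1 - h \<longrightarrow> omega s = t + h \<longrightarrow> omega q = t - h \<longrightarrow>
     0 \<le> h \<longrightarrow> h \<le> t\<^sup>2 \<longrightarrow> 0 < t \<longrightarrow> t \<le> 1/8 \<longrightarrow> \<bar>bracket p q r s\<bar> \<le> C * t^5"
proof -
  \<comment> \<open>50 is a generous common bound for \<open>t\<close>, \<open>d^2\<close>,
    \<open>u\<close> and \<open>v\<close>; the estimates \<open>W3\<close> and \<open>Y2\<close>
    below justify it.\<close>
  obtain C where C: "C > 0" "\<forall>t g u v. \<bar>t\<bar> \<le> 50 \<and> \<bar>g\<bar> \<le> 50 \<and> \<bar>u\<bar> \<le> 50 \<and> \<bar>v\<bar> \<le> 50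
      \<longrightarrow> \<bar>remainder t g u v\<bar> \<le> C"
    using remainder_bounded[of 50] by (elim exE conjE)
  have "\<bar>bracket p q r s\<bar> \<le> (8 * C + 3000) * t^5"
    if mom: "p + q = r + s"
      and om: "omega p = 1 + h" "omega r = 1 - h" "omega s = t + h" "omega q = t - h"
      and ht: "0 \<le> h" "h \<le> t\<^sup>2" "0 < t" "t \<le> 1/8"
    for p q r s :: 'a and t h :: real
  proof -
    \<comment> \<open>\<open>P - S\<close> and \<open>P' - S'\<close> are the denominators of the
      channels \<open>p + q\<close> and \<open>p - s\<close>; \<open>z\<close> and \<open>z'\<close>
      are their counterparts without square roots.\<close>
    define P P' S S' where PS: "P = norm (p + q)" "P' = norm (p - s)" "S = (1 + t)\<^sup>2" "S' = (1 - t)\<^sup>2"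
    define A B A' B' where AB: "A = (1+h)*(t-h)" "B = (1-h)*(t+h)" "A' = -((1+h)*(t+h))" "B' = -((1-h)*(t-h))"
    define z z' where z: "z = (P\<^sup>2 - S\<^sup>2) / 2" "z' = (P'\<^sup>2 - S'\<^sup>2) / 2"
    define x y x' y' where xy: "x = f_minus p q" "y = f_minus r s" "x' = - f_plus p s" "y' = - f_plus q r"
    have n: "norm p = (1+h)\<^sup>2" "norm q = (t-h)\<^sup>2" "norm r = (1-h)\<^sup>2" "norm s = (t+h)\<^sup>2"
      by (simp_all add: norm_eq_omega om)
    have tt: "t\<^sup>2 \<le> t / 8" "h \<le> t / 8" "h \<le> 1/64"
    proof -
      show "t\<^sup>2 \<le> t / 8" using ht mult_left_mono[of t "1/8" t] by (simp add: power2_eq_square)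
      then show "h \<le> t / 8" "h \<le> 1/64" using ht by linarith+
    qed
    have hh: "h * t \<ge> 0" "h * h \<ge> 0" "h * h \<le> h" "h * t \<le> h"
      using ht tt by (auto intro: mult_left_le)
    have eqs: "norm (r + s) = P" "norm (q - r) = P'" "norm (p - r) = norm (q - s)"
    proof -
      have p: "p = r + s - q" using mom by (simp add: eq_diff_eq)
      show "norm (r + s) = P" "norm (q - r) = P'" "norm (p - r) = norm (q - s)"
        unfolding PS p by (simp_all add: norm_minus_commute)
    qed
    \<comment> \<open>As \<open>norm p + norm q = S - 2 * A\<close> and
      \<open>norm r + norm s = S - 2 * B\<close>, the common norm \<open>P\<close> of both sums
      determines \<open>x\<close> and \<open>y\<close>; \<open>P'\<close> does the same for
      \<open>x'\<close> and \<open>y'\<close>. Given the frequencies, only \<open>z\<close> and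
      \<open>z'\<close> remain unknown.\<close>
    have xz: "x = z + 2 * A * (S - A)" "y = z + 2 * B * (S - B)"
      "x' = z' + 2 * A' * (S' - A')" "y' = z' + 2 * B' * (S' - B')"
    proof -
      have sums: "norm p + norm q = S - 2 * A" "norm r + norm s = S - 2 * B"
        "norm p + norm s = S' - 2 * A'" "norm q + norm r = S' - 2 * B'"
        unfolding n PS AB by algebra+
      have "2 * x = P\<^sup>2 - (S - 2 * A)\<^sup>2"
        using norm_add_sq[of p q] unfolding sums xy(1) PS(1) by simp
      then show "x = z + 2 * A * (S - A)" unfolding z by algebra
      have "2 * y = P\<^sup>2 - (S - 2 * B)\<^sup>2"
        using norm_add_sq[of r s] unfolding sums xy(2) eqs by simp
      then show "y = z + 2 * B * (S - B)" unfolding z by algebra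
      have "2 * x' = P'\<^sup>2 - (S' - 2 * A')\<^sup>2"
        using norm_diff_sq[of p s] unfolding sums xy(3) PS(2) by simp
      then show "x' = z' + 2 * A' * (S' - A')" unfolding z by algebra
      have "2 * y' = P'\<^sup>2 - (S' - 2 * B')\<^sup>2"
        using norm_diff_sq[of q r] unfolding sums xy(4) eqs by simp
      then show "y' = z' + 2 * B' * (S' - B')" unfolding z by algebra
    qed
    define V where "V = (norm (q - s))\<^sup>2"
    \<comment> \<open>Momentum conservation makes the squared norms of \<open>p + q\<close>,
      \<open>p - s\<close> and \<open>q - s\<close> linearly dependent, like the Mandelstam
      variables of a scattering process.\<close>
    have V: "P\<^sup>2 + P'\<^sup>2 + V = (norm p)\<^sup>2 + (norm q)\<^sup>2 + (norm r)\<^sup>2 + (norm s)\<^sup>2"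
    proof -
      have r: "r = p + q - s" using mom by simp
      show ?thesis
        unfolding PS V_def r by (simp add: power2_norm_eq_inner inner_simps inner_commute algebra_simps)
    qed
    have Vle: "0 \<le> V" "V \<le> 16 * t^4"
    proof -
      have "norm (q - s) \<le> (t-h)\<^sup>2 + (t+h)\<^sup>2"
        using norm_triangle_ineq4[of q s] by (simp add: n)
      also have "\<dots> = 2 * t\<^sup>2 + 2 * h\<^sup>2" by (simp add: power2_eq_square algebra_simps)
      also have "\<dots> \<le> 4 * t\<^sup>2" using ht hh by (simp add: power2_eq_square)
      finally show "V \<le> 16 * t^4"
        unfolding V_def using power_mono[of "norm (q - s)" "4 * t\<^sup>2" 2] by (simp add: power_mult_distrib)
    qed (simp add: V_def)

    \<comment> \<open>The parallelogram identity \<open>V\<close> fixes \<open>z + z'\<close> up to \<open>O(t^4)\<close>; \<open>z' - z\<close> contains the free angle.\<close>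
    define W Y where WY: "W = (z + z') / 2" "Y = (z' - z) / 2"
    have zWY: "z = W - Y" "z' = W + Y" unfolding WY by (simp_all add: field_simps)
    \<comment> \<open>The leading terms are \<open>2 * t\<close> for \<open>Y\<close> and
      \<open>-3 * t^2\<close> for \<open>W\<close>; \<open>d\<close>, \<open>u\<close>,
      \<open>v\<close> are the rest, in the scaling that keeps it bounded as \<open>t\<close> tends
      to 0.\<close>
    define d u v where duv: "d = h / t\<^sup>2" "u = (Y - 2 * t) / t\<^sup>2" "v = (W + 3 * t\<^sup>2) / t^4"
    have W: "W = 3 * (h\<^sup>2 + t\<^sup>2 * h\<^sup>2 - t\<^sup>2) + h^4 - V / 4"
    proof -
      have "4 * W = P\<^sup>2 + P'\<^sup>2 - S\<^sup>2 - S'\<^sup>2"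
        unfolding WY z by (simp add: field_simps)
      then have "4 * W = (1+h)^4 + (t-h)^4 + (1-h)^4 + (t+h)^4 - V - S\<^sup>2 - S'\<^sup>2"
        using V unfolding n by (simp flip: power_mult)
      then show ?thesis unfolding PS by algebra
    qed
    have h4: "h\<^sup>2 \<le> t^4" "h^4 \<le> t^4" "t\<^sup>2 * h\<^sup>2 \<le> t^4" "t^4 \<le> t\<^sup>2"
    proof -
      show *: "h\<^sup>2 \<le> t^4" using power_mono[OF ht(2,1), of 2] by (simp flip: power_mult)
      have "h^4 \<le> h\<^sup>2" using ht tt by (intro power_decreasing) auto
      then show "h^4 \<le> t^4" using * by simp
      have "t\<^sup>2 * h\<^sup>2 \<le> 1 * h\<^sup>2" using ht by (intro mult_right_mono power_le_one) auto
      then show "t\<^sup>2 * h\<^sup>2 \<le> t^4" using * by simp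
      show "t^4 \<le> t\<^sup>2" using ht by (intro power_decreasing) auto
    qed
    have W3: "\<bar>W + 3 * t\<^sup>2\<bar> \<le> 11 * t^4"
    proof -
      have "0 \<le> h\<^sup>2" "0 \<le> t\<^sup>2 * h\<^sup>2" "0 \<le> h^4" "0 \<le> t^4" by simp_all
      moreover have "W + 3 * t\<^sup>2 = 3 * h\<^sup>2 + 3 * (t\<^sup>2 * h\<^sup>2) + h^4 - V / 4"
        unfolding W by algebra
      ultimately show ?thesis
        using h4 Vle by linarith
    qed
    have A: "0 \<le> A" "A \<le> t" "0 \<le> B" "B \<le> 2 * t" "0 \<le> - A'" "- A' \<le> 4 * t" "0 \<le> - B'" "- B' \<le> t"
      and Ad: "\<bar>A - t\<bar> \<le> 4 * t\<^sup>2"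
    proof -
      have "A = t - h + h * t - h * h" "B = t + h - h * t - h * h"
        "- A' = t + h + h * t + h * h" "- B' = t - h - h * t + h * h"
        unfolding AB by algebra+
      then show "A \<le> t" "B \<le> 2 * t" "- A' \<le> 4 * t" "- B' \<le> t" "\<bar>A - t\<bar> \<le> 4 * t\<^sup>2"
        using ht tt hh by linarith+
      show "0 \<le> A" "0 \<le> B" "0 \<le> - A'" "0 \<le> - B'"
        using ht tt by (auto simp: AB)
    qed
    have xle: "\<bar>x\<bar> \<le> 2 * t\<^sup>2" "\<bar>y\<bar> \<le> 8 * t\<^sup>2" "\<bar>x'\<bar> \<le> 32 * t\<^sup>2" "\<bar>y'\<bar> \<le> 2 * t\<^sup>2"
    proof -
      have "norm p * norm q = A\<^sup>2" "norm r * norm s = B\<^sup>2"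
        "norm p * norm s = (- A')\<^sup>2" "norm q * norm r = (- B')\<^sup>2"
        unfolding n AB by algebra+
      then have "\<bar>x\<bar> \<le> 2 * A\<^sup>2" "\<bar>y\<bar> \<le> 2 * B\<^sup>2" "\<bar>x'\<bar> \<le> 2 * (- A')\<^sup>2" "\<bar>y'\<bar> \<le> 2 * (- B')\<^sup>2"
        using abs_f_minus_le[of p q] abs_f_minus_le[of r s] abs_f_plus_le[of p s] abs_f_plus_le[of q r]
        unfolding xy by simp_all
      then show "\<bar>x\<bar> \<le> 2 * t\<^sup>2" "\<bar>y\<bar> \<le> 8 * t\<^sup>2" "\<bar>x'\<bar> \<le> 32 * t\<^sup>2" "\<bar>y'\<bar> \<le> 2 * t\<^sup>2"
        using power_mono[OF A(2,1), of 2] power_mono[OF A(4,3), of 2]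
          power_mono[OF A(6,5), of 2] power_mono[OF A(8,7), of 2]
        by (simp_all add: power_mult_distrib)
    qed
    have Y2: "\<bar>Y - 2 * t\<bar> \<le> 50 * t\<^sup>2"
    proof -
      define G where "G = A * (2 * t + t\<^sup>2)"
      \<comment> \<open>This is the equation for \<open>x\<close> in \<open>xz\<close> solved for
        \<open>Y\<close>, with \<open>S = 1 + 2 * t + t^2\<close>. The angle enters through
        \<open>x\<close>, which Cauchy-Schwarz makes \<open>O(t^2)\<close>.\<close>
      have "Y - 2 * t = (W + 3 * t\<^sup>2) - 3 * t\<^sup>2 - x + 2 * (A - t) + 2 * G - 2 * A\<^sup>2"
        using xz(1) zWY(1) PS(3) by (simp add: G_def power2_eq_square algebra_simps)
      moreover have "A\<^sup>2 \<le> t\<^sup>2" using power_mono[OF A(2,1), of 2] .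
      moreover have "G \<le> 3 * t\<^sup>2"
        using mult_mono[of A t "2 * t + t\<^sup>2" "3 * t"] A ht tt by (simp add: G_def power2_eq_square)
      moreover have "0 \<le> G" using A ht by (simp add: G_def)
      moreover have "0 \<le> A\<^sup>2" by simp
      ultimately show ?thesis
        using W3 h4(4) xle(1) Ad unfolding abs_le_iff by argo
    qed
    have duv': "h = t\<^sup>2 * d" "W = - 3 * t\<^sup>2 + t^4 * v" "Y = 2 * t + t\<^sup>2 * u"
      using ht by (auto simp: duv)
    have "\<bar>d\<^sup>2\<bar> \<le> 50"
      using ht power_le_one[of d 2] by (simp add: duv)
    moreover have "\<bar>u\<bar> \<le> 50" "\<bar>v\<bar> \<le> 50"
      using Y2 W3 ht by (auto simp: duv abs_divide divide_le_eq)
    ultimately have rem: "\<bar>remainder t (d\<^sup>2) u v\<bar> \<le> C"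
      using ht C(2) by simp

    have S: "1 \<le> S" "1/2 \<le> S'"
      using ht one_le_power[of "1+t" 2] power_mono[of "7/8" "1-t" 2] by (auto simp: PS power2_eq_square)
    have PP: "0 \<le> P" "0 \<le> P'" by (auto simp: PS)
    have D: "t \<le> S - P" "S - P \<le> 4 * t" "t \<le> P' - S'" "P' - S' \<le> 8 * t"
    proof -
      have exp: "norm p + norm q = 1 + 2 * h + 2 * (h * h) + t\<^sup>2 - 2 * (h * t)"
        "norm p - norm q = 1 + 2 * h - t\<^sup>2 + 2 * (h * t)"
        "norm p - norm s = 1 + 2 * h - t\<^sup>2 - 2 * (h * t)"
        "norm p + norm s = 1 + 2 * h + 2 * (h * h) + t\<^sup>2 + 2 * (h * t)"
        "S = 1 + 2 * t + t\<^sup>2" "S' = 1 - 2 * t + t\<^sup>2"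
        unfolding n PS by algebra+
      show "t \<le> S - P"
        using norm_triangle_ineq[of p q] ht tt hh unfolding exp PS(1) by linarith
      show "S - P \<le> 4 * t"
        using norm_diff_ineq[of p q] ht tt hh unfolding exp PS(1) by linarith
      show "t \<le> P' - S'"
        using norm_triangle_ineq2[of p s] ht tt hh unfolding exp PS(2) by linarith
      show "P' - S' \<le> 8 * t"
        using norm_triangle_ineq4[of p s] ht tt hh unfolding exp PS(2) by linarith
    qed
    have zz: "t\<^sup>2 / 8 \<le> \<bar>z * z'\<bar>"
    proof -
      have "t * 1 \<le> (S - P) * (S + P)" using D S PP ht by (intro mult_mono) auto
      then have 1: "t / 2 \<le> - z" unfolding z by (simp add: field_simps power2_eq_square)
      have "t * (1/2) \<le> (P' - S') * (P' + S')" using D S PP ht by (intro mult_mono) auto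
      then have 2: "t / 4 \<le> z'" unfolding z by (simp add: field_simps power2_eq_square)
      have "(t / 2) * (t / 4) \<le> (- z) * z'" using 1 2 ht by (intro mult_mono) auto
      then show ?thesis by (simp add: power2_eq_square abs_le_iff)
    qed
    then have z0: "z \<noteq> 0" "z' \<noteq> 0" using ht by auto
    \<comment> \<open>\<open>M\<close> holds the product of the norms and the channels
      \<open>p + q\<close> and \<open>p - s\<close>, each quotient being replaced by the first two
      terms of \<open>quotient_expansion\<close>.\<close>
    define M where "M = -2*S*(B*x+A*y) + (x+2*A^2)*(y+2*B^2) + 2*x*y
      - 2*S'*(B'*x'+A'*y') + (x'+2*A'^2)*(y'+2*B'^2) + 2*x'*y' - 12*A^2*B^2
      + 4*S^2*x*y/z + 4*S'^2*x'*y'/z'"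
    have Mzz: "M * (z * z') = t^7 * remainder t (d\<^sup>2) u v"
    proof -
      have "M * (z * z') = (-2*S*(B*x+A*y) + (x+2*A^2)*(y+2*B^2) + 2*x*y
      - 2*S'*(B'*x'+A'*y') + (x'+2*A'^2)*(y'+2*B'^2) + 2*x'*y' - 12*A^2*B^2)*z*z'
      + 4*S^2*x*y*z' + 4*S'^2*x'*y'*z"
        unfolding M_def using z0 by (simp add: distrib_right)
      also have "\<dots> = t^7 * remainder t (d\<^sup>2) u v"
      proof (rule cancellation[OF duv'(1) PS(3,4) AB _ _ xz])
        show "z = (- 3 * t\<^sup>2 + t^4 * v) - (2 * t + t\<^sup>2 * u)" "z' = (- 3 * t\<^sup>2 + t^4 * v) + (2 * t + t\<^sup>2 * u)"
          unfolding duv'(2,3)[symmetric] by (fact zWY)+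
      qed
      finally show ?thesis .
    qed
    have "\<bar>M\<bar> * (t\<^sup>2 / 8) \<le> \<bar>M\<bar> * \<bar>z * z'\<bar>"
      using zz by (intro mult_left_mono) auto
    also have "\<dots> = t^7 * \<bar>remainder t (d\<^sup>2) u v\<bar>"
      unfolding abs_mult[symmetric] Mzz using ht(3) by (simp add: abs_mult)
    also have "\<dots> \<le> t^7 * C"
      using rem ht(3) by (intro mult_left_mono) auto
    also have "\<dots> = (8 * C * t^5) * (t\<^sup>2 / 8)"
      by (simp add: eval_nat_numeral)
    finally have "\<bar>M\<bar> * (t\<^sup>2 / 8) \<le> (8 * C * t^5) * (t\<^sup>2 / 8)" .
    then have M: "\<bar>M\<bar> \<le> 8 * C * t^5"
      by (rule mult_right_le_imp_le) (use ht in simp)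

    have t56: "t^6 \<le> t^5" "t^8 \<le> t^5" using ht by (auto intro!: power_decreasing)
    \<comment> \<open>The third terms of the two expansions: \<open>x * y\<close> and
      \<open>x' * y'\<close> are \<open>O(t^4)\<close>, the differences \<open>O(t)\<close>, and the
      sums below the fraction bar stay away from 0.\<close>
    define E E' where E: "E = 2 * x * y * (P - S) / (P + S)" "E' = 2 * x' * y' * (P' - S') / (P' + S')"
    have "\<bar>2 * x * y * (P - S)\<bar> \<le> 2 * (2 * t\<^sup>2) * (8 * t\<^sup>2) * (4 * t)"
      using xle D ht by (intro abs_mult_le) auto
    also have "\<dots> = 128 * t^5" by (simp add: eval_nat_numeral)
    also have "\<dots> \<le> (128 * t^5) * (P + S)" 
      using mult_left_mono[of 1 "P + S" "128 * t^5"] S PP ht by simp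
    finally have E1: "\<bar>E\<bar> \<le> 128 * t^5"
      using S PP by (simp add: E abs_divide divide_le_eq)
    have "\<bar>2 * x' * y' * (P' - S')\<bar> \<le> 2 * (32 * t\<^sup>2) * (2 * t\<^sup>2) * (8 * t)"
      using xle D ht by (intro abs_mult_le) auto
    also have "\<dots> = (2048 * t^5) * (1/2)" by (simp add: eval_nat_numeral)
    also have "\<dots> \<le> (2048 * t^5) * (P' + S')" using S PP ht by (intro mult_left_mono) auto
    finally have E2: "\<bar>E'\<bar> \<le> 2048 * t^5"
      using S PP by (simp add: E abs_divide divide_le_eq)

    have f: "\<bar>f_plus p r\<bar> \<le> 2" "\<bar>f_plus q s\<bar> \<le> 2 * t^4" "\<bar>f_minus q s\<bar> \<le> 2 * t^4" "\<bar>f_minus p r\<bar> \<le> 8 * t^4"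
    proof -
      have "norm p * norm r = (1 - h\<^sup>2)\<^sup>2" by (simp add: n) algebra
      moreover have "(1 - h\<^sup>2)\<^sup>2 \<le> 1" using ht tt hh by (intro power_le_one) (auto simp: power2_eq_square)
      ultimately show "\<bar>f_plus p r\<bar> \<le> 2" using abs_f_plus_le[of p r] by simp
      have "norm q * norm s = (t\<^sup>2 - h\<^sup>2)\<^sup>2" by (simp add: n) algebra
      moreover have "(t\<^sup>2 - h\<^sup>2)\<^sup>2 \<le> (t\<^sup>2)\<^sup>2"
        using h4 by (intro power_mono) auto
      ultimately have "norm q * norm s \<le> t^4" by simp
      then show "\<bar>f_plus q s\<bar> \<le> 2 * t^4" "\<bar>f_minus q s\<bar> \<le> 2 * t^4"
        using abs_f_plus_le[of q s] abs_f_minus_le[of q s] by linarith+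
      \<comment> \<open>Cauchy-Schwarz would give only \<open>O(1)\<close>. But
        \<open>p - r = s - q\<close> has norm \<open>O(t^2)\<close> and the lengths of
        \<open>p\<close> and \<open>r\<close> differ by \<open>4 * h\<close>, so the two vectors
        nearly coincide.\<close>
      have "2 * f_minus p r = (norm p - norm r)\<^sup>2 - V"
        using norm_diff_sq'[of p r] by (simp add: eqs V_def)
      moreover have "(norm p - norm r)\<^sup>2 = 16 * h\<^sup>2" by (simp add: n) algebra
      moreover have "0 \<le> h\<^sup>2" by simp
      ultimately show "\<bar>f_minus p r\<bar> \<le> 8 * t^4"
        using Vle h4(1) by argo
    qed
    have h2: "\<bar>(2 * h)\<^sup>2\<bar> \<le> 4 * t^4" using h4 by (simp add: power_mult_distrib)
    have w: "\<bar>(t - h) * (t + h)\<bar> \<le> t\<^sup>2" "\<bar>(1 + h) * (1 - h)\<bar> \<le> 1"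
    proof -
      have "(t - h) * (t + h) = t\<^sup>2 - h\<^sup>2" "(1 + h) * (1 - h) = 1 - h\<^sup>2" by algebra+
      moreover have "h\<^sup>2 \<le> 1" using ht(1) tt by (intro power_le_one) auto
      ultimately show "\<bar>(t - h) * (t + h)\<bar> \<le> t\<^sup>2" "\<bar>(1 + h) * (1 - h)\<bar> \<le> 1"
        using h4 by (simp_all add: abs_le_iff)
    qed
    have t2: "\<bar>2 * (2 * h)\<^sup>2 * ((t - h) * (t + h) * f_plus p r + (1 + h) * (1 - h) * f_plus q s)\<bar> \<le> 32 * t^6"
    proof -
      have "\<bar>2 * (2 * h)\<^sup>2 * ((t - h) * (t + h) * f_plus p r + (1 + h) * (1 - h) * f_plus q s)\<bar>
          \<le> 2 * (4 * t^4) * (t\<^sup>2 * 2 + 1 * (2 * t^4))"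
        by (intro abs_mult_le abs_add_le f h2 w) simp
      also have "\<dots> \<le> 2 * (4 * t^4) * (4 * t\<^sup>2)" using h4 ht by (intro mult_left_mono) auto
      also have "\<dots> = 32 * t^6" by (simp add: eval_nat_numeral)
      finally show ?thesis .
    qed
    have t5: "\<bar>f_minus p r * f_minus q s\<bar> \<le> 16 * t^8"
      using abs_mult_le[OF f(4,3)] by (simp add: eval_nat_numeral)
    have t8: "\<bar>4 * (2 * h)\<^sup>2 * f_plus p r * f_plus q s / ((omega (p - r))\<^sup>2 - (2 * h)\<^sup>2)\<bar> \<le> 32 * t^6"
    proof -
      \<comment> \<open>With \<open>w = w' = 2 * h\<close> this includes \<open>h = 0\<close>;
        \<open>F = 4\<close> suffices because \<open>1 - h\<close> exceeds 1/2.\<close>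
      have "\<bar>4 * (2 * h * (2 * h)) * f_plus p r * f_plus q s / ((omega (p - r))\<^sup>2 - (2 * h)\<^sup>2)\<bar>
          \<le> 2 * \<bar>2 * h\<bar> * 4 * (2 * t^4)"
      proof (rule abs_quotient_le)
        show "2 * ((1 - h) * (2 * h)) \<le> \<bar>(omega (p - r))\<^sup>2 - (2 * h)\<^sup>2\<bar>"
          using denominator_minus_ge[of r p] ht by (simp add: om)
        show "\<bar>f_plus p r\<bar> \<le> (1 - h) * 4" using f tt by simp
      qed (use ht tt f in auto)
      also have "\<dots> \<le> 2 * (2 * t\<^sup>2) * 4 * (2 * t^4)"
        using ht by (intro mult_right_mono mult_left_mono) auto
      also have "\<dots> = 32 * t^6" by (simp add: eval_nat_numeral)
      finally show ?thesis using ht by (simp add: power2_eq_square)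
    qed
    have "bracket p q r s = M - E - E'
        - 2 * (2 * h)\<^sup>2 * ((t - h) * (t + h) * f_plus p r + (1 + h) * (1 - h) * f_plus q s)
        + f_minus p r * f_minus q s
        + 4 * (2 * h)\<^sup>2 * f_plus p r * f_plus q s / ((omega (p - r))\<^sup>2 - (2 * h)\<^sup>2)"
    proof -
      have q1: "4 * S * x * y / (P - S) = 4 * S\<^sup>2 * x * y / z + 2 * x * y - E"
        unfolding E using D ht PP S by (intro quotient_expansion z) auto
      have q2: "4 * S' * x' * y' / (P' - S') = 4 * S'\<^sup>2 * x' * y' / z' + 2 * x' * y' - E'"
        unfolding E using D ht PP S by (intro quotient_expansion z) auto
      have o: "(omega (p + q))\<^sup>2 = P" "(omega (p - s))\<^sup>2 = P'"
        "(omega p + omega q)\<^sup>2 = S" "(omega p - omega s)\<^sup>2 = S'" "(omega p - omega r)\<^sup>2 = (2 * h)\<^sup>2"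
        by (simp_all add: PS norm_eq_omega om)
      have g: "f_plus p q = x + 2 * A\<^sup>2" "f_plus r s = y + 2 * B\<^sup>2"
        "f_minus p s = - (x' + 2 * A'\<^sup>2)" "f_minus q r = - (y' + 2 * B'\<^sup>2)"
        using f_plus_conv_f_minus[of p q] f_plus_conv_f_minus[of r s]
          f_plus_conv_f_minus[of p s] f_plus_conv_f_minus[of q r]
        by (simp_all add: xy AB n power_mult_distrib)
      have g': "f_minus p q = x" "f_minus r s = y" "f_plus p s = - x'" "f_plus q r = - y'"
        by (simp_all add: xy)
      have AB2: "- 12 * norm p * norm q * norm r * norm s = - 12 * A\<^sup>2 * B\<^sup>2"
        unfolding n AB by algebra
      have o2: "omega r * omega s = B" "omega p * omega q = A" "omega q * omega r = - B'"
        "omega p * omega s = - A'" "omega q * omega s = (t - h) * (t + h)"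
        "omega p * omega r = (1 + h) * (1 - h)"
        by (simp_all add: om AB)
      have "4 * S' * (- x') * (- y') / (P' - S') = 4 * S'\<^sup>2 * x' * y' / z' + 2 * x' * y' - E'"
        using q2 by simp
      note q = q1 this
      show ?thesis
        unfolding bracket_def o o2 g g' q AB2 M_def by (simp add: algebra_simps)
    qed
    also have "\<bar>\<dots>\<bar> \<le> 8 * C * t^5 + 128 * t^5 + 2048 * t^5 + 32 * t^6 + 16 * t^8 + 32 * t^6"
      by (intro abs_sum6_le M E1 E2 t2 t5 t8)
    also have "\<dots> \<le> 8 * C * t^5 + 3000 * t^5"
    proof -
      have "0 \<le> t^5" using ht by simp
      then show ?thesis using t56 by linarith
    qed
    finally show ?thesis by (simp only: distrib_right)
  qed
  moreover have "8 * C + 3000 > 0" using C by simp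
  ultimately show ?thesis by blast
qed

section \<open>Scaling and symmetries\<close>

lemma omega_scaleR: "l \<ge> 0 \<Longrightarrow> omega (l *\<^sub>R x) = sqrt l * omega x"
  by (simp add: omega_def powr_half_sqrt real_sqrt_mult)

lemma bracket_scaleR:
  assumes "l > 0"
  shows "bracket (l *\<^sub>R p) (l *\<^sub>R q) (l *\<^sub>R r) (l *\<^sub>R s) = l^4 * bracket p q r s"
proof -
  have f: "f_plus (l *\<^sub>R x) (l *\<^sub>R y) = l\<^sup>2 * f_plus x y"
    "f_minus (l *\<^sub>R x) (l *\<^sub>R y) = l\<^sup>2 * f_minus x y" for x y :: 'a
    using assms by (simp_all add: f_plus_def f_minus_def power2_eq_square algebra_simps)
  have o: "(omega (l *\<^sub>R x) + omega (l *\<^sub>R y))\<^sup>2 = l * (omega x + omega y)\<^sup>2"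
    "(omega (l *\<^sub>R x) - omega (l *\<^sub>R y))\<^sup>2 = l * (omega x - omega y)\<^sup>2"
    "omega (l *\<^sub>R x) * omega (l *\<^sub>R y) = l * (omega x * omega y)"
    "norm (l *\<^sub>R x) = l * norm x" "(omega (l *\<^sub>R x))\<^sup>2 = l * (omega x)\<^sup>2" for x y :: 'a
    using assms by (simp_all add: omega_scaleR power_mult_distrib
      flip: distrib_left right_diff_distrib)
  have q: "4 * (l * w) * (l\<^sup>2 * F) * (l\<^sup>2 * G) / (l * a - l * b) = l^4 * (4 * w * F * G / (a - b))"
    for w F G a b :: real
  proof -
    have "4 * (l * w) * (l\<^sup>2 * F) * (l\<^sup>2 * G) / (l * a - l * b)
        = (l * (l^4 * (4 * w * F * G))) / (l * (a - b))"
      by (simp add: right_diff_distrib eval_nat_numeral mult_ac)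
    then show ?thesis using assms by simp
  qed
  show ?thesis
    unfolding bracket_def scaleR_add_right[symmetric] scaleR_diff_right[symmetric] o f q
    by (simp add: eval_nat_numeral algebra_simps)
qed

text \<open>The braces have degree 4 and the prefactor degree -1. The target
  \<open>(norm s)\<^sup>2 * norm p\<close> has degree 3 too, which permits the normalization
  \<open>omega p + omega r = 2\<close>.\<close>

lemma T_tilde_scaleR:
  assumes "l > 0"
  shows "T_tilde (l *\<^sub>R p) (l *\<^sub>R q) (l *\<^sub>R r) (l *\<^sub>R s) = l^3 * T_tilde p q r s"
proof -
  have "sqrt l * x * (sqrt l * y) * (sqrt l * z) * (sqrt l * w) = l\<^sup>2 * (x * y * z * w)" for x y z w
  proof -
    have "sqrt l * x * (sqrt l * y) * (sqrt l * z) * (sqrt l * w)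
        = (sqrt l * sqrt l) * (sqrt l * sqrt l) * (x * y * z * w)"
      by (simp only: mult_ac)
    then show ?thesis using assms by (simp add: power2_eq_square)
  qed
  then have "sqrt (omega (l *\<^sub>R p) * omega (l *\<^sub>R q) * omega (l *\<^sub>R r) * omega (l *\<^sub>R s))
      = l * sqrt (omega p * omega q * omega r * omega s)"
    using assms by (simp only: omega_scaleR less_imp_le real_sqrt_mult[of "l\<^sup>2"] real_sqrt_abs abs_of_pos)
  then show ?thesis
    using assms by (simp add: T_tilde_eq bracket_scaleR eval_nat_numeral)
qed

section \<open>The estimate for ordered resonances\<close>

text \<open>Once \<open>omega p\<close> is maximal, resonance forces its partner
  \<open>omega q\<close> to be minimal, so up to the symmetries below this order is the general
  case. Positivity of \<open>omega q\<close> makes all four vectors nonzero.\<close>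

definition resonant_ordered :: "'a::real_inner \<Rightarrow> 'a \<Rightarrow> 'a \<Rightarrow> 'a \<Rightarrow> bool" where
  "resonant_ordered p q r s \<longleftrightarrow> p + q = r + s \<and> omega p + omega q = omega r + omega s \<and>
     0 < omega q \<and> omega q \<le> omega s \<and> omega s \<le> omega r \<and> omega r \<le> omega p"

lemma T_tilde_le_normalized:
  "\<exists>C>0. \<forall>(p::'a::real_inner) q r s. resonant_ordered p q r s \<longrightarrow> omega p + omega r = 2 \<longrightarrow>
     \<bar>T_tilde p q r s\<bar> \<le> C * ((norm s)\<^sup>2 * norm p)"
proof -
  obtain C where C: "C > 0" "\<forall>(p::'a) q r s t h.
     p + q = r + s \<longrightarrow> omega p = 1 + h \<longrightarrow> omega r = 1 - h \<longrightarrow> omega s = t + h \<longrightarrow> omega q = t - h \<longrightarrow>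
     0 \<le> h \<longrightarrow> h \<le> t\<^sup>2 \<longrightarrow> 0 < t \<longrightarrow> t \<le> 1/8 \<longrightarrow> \<bar>bracket p q r s\<bar> \<le> C * t^5"
    using bracket_le_long_waves by (elim exE conjE)
  define K :: real where "K = 2 * C + 30000 * 16 * 8^4"
  have "\<bar>T_tilde p q r s\<bar> \<le> K * ((norm s)\<^sup>2 * norm p)"
    if res: "resonant_ordered p q r s" and unit: "omega p + omega r = 2" for p q r s :: 'a
  proof -
    define h t where ht: "h = (omega p - omega r) / 2" "t = (omega q + omega s) / 2"
    have om: "omega p = 1 + h" "omega r = 1 - h" "omega s = t + h" "omega q = t - h"
      using res unit unfolding resonant_ordered_def ht by (auto simp: field_simps)
    have mom: "p + q = r + s" and bd: "0 \<le> h" "h < t" "t + h \<le> 1 - h"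
      using res unfolding resonant_ordered_def om by auto
    \<comment> \<open>Both regimes are compared with \<open>t^4\<close>.\<close>
    have RHS: "t^4 \<le> (norm s)\<^sup>2 * norm p"
    proof -
      have "t^4 * 1 \<le> (t + h)^4 * (1 + h)\<^sup>2"
        using bd by (intro mult_mono power_mono one_le_power) auto
      then show ?thesis by (simp add: norm_eq_omega om flip: power_mult)
    qed
    show ?thesis
    proof (cases "t \<le> 1/8")
      case True
      \<comment> \<open>Momentum conservation bounds \<open>norm p - norm r = 4 * h\<close> by
        \<open>norm s + norm q = 2 * t^2 + 2 * h^2\<close>, and \<open>h^2\<close> is absorbed on
        the left.\<close>
      have h: "h \<le> t\<^sup>2"
      proof -
        have "norm p - norm r \<le> norm (p - r)" by (rule norm_triangle_ineq2)
        also have "p - r = s - q" using mom by (simp add: algebra_simps)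
        also have "norm \<dots> \<le> norm s + norm q" by (rule norm_triangle_ineq4)
        finally have "4 * h \<le> 2 * t\<^sup>2 + 2 * h\<^sup>2"
          unfolding norm_eq_omega om by (simp add: power2_eq_square algebra_simps)
        moreover have "h\<^sup>2 \<le> h" using bd True by (simp add: power2_eq_square mult_left_le)
        ultimately show ?thesis using bd by linarith
      qed
      have t2: "t\<^sup>2 \<le> t / 8" using mult_left_mono[OF True, of t] bd by (simp add: power2_eq_square)
      \<comment> \<open>The four frequencies are at least 1, \<open>t / 2\<close>, 1/2 and
        \<open>t\<close>. The prefactor thus costs one power of \<open>t\<close> and turns
        \<open>t^5\<close> into \<open>t^4\<close>.\<close>
      have "(t / 2)\<^sup>2 \<le> omega p * omega q * omega r * omega s"
      proof -
        have "(t / 2)\<^sup>2 = 1 * (t / 2) * (1 / 2) * t" by (simp add: power2_eq_square)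
        also have "\<dots> \<le> omega p * omega q * omega r * omega s"
          unfolding om using bd h t2 True by (intro mult_mono mult_nonneg_nonneg) auto
        finally show ?thesis .
      qed
      then have "\<bar>T_tilde p q r s\<bar> \<le> \<bar>bracket p q r s\<bar> / (t / 2)"
        using bd by (intro abs_T_tilde_le) auto
      also have "\<dots> \<le> (C * t^5) / (t / 2)"
        using C(2) mom om bd h True by (intro divide_right_mono) auto
      also have "\<dots> = 2 * C * t^4" using bd by (simp add: field_simps eval_nat_numeral)
      also have "\<dots> \<le> K * t^4" by (intro mult_right_mono) (auto simp: K_def)
      also have "\<dots> \<le> K * ((norm s)\<^sup>2 * norm p)"
        using C RHS by (intro mult_left_mono) (auto simp: K_def)
      finally show ?thesis .
    next
      case False
      \<comment> \<open>Now \<open>omega p\<close> is at least 1 and \<open>omega r\<close>,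
        \<open>omega s\<close> at least 1/8, so the prefactor is \<open>O(1 / omega q)\<close>,
        which \<open>bracket_le_smallest\<close> compensates. The constant left over is absorbed by
        \<open>t^4\<close>, which exceeds \<open>1 / 8^4\<close>.\<close>
      define m where "m = omega q / 16"
      have q: "0 < omega q" "omega q \<le> 1" using bd om by auto
      have "m\<^sup>2 \<le> omega p * omega q * omega r * omega s"
      proof -
        have "m\<^sup>2 = (omega q * omega q) / 256" by (simp add: m_def power2_eq_square)
        also have "\<dots> \<le> 1 * omega q * (1/8) * (1/8)"
          using mult_left_mono[of "omega q" 1 "omega q"] q by simp
        also have "\<dots> \<le> omega p * omega q * omega r * omega s"
          unfolding om using bd False by (intro mult_mono mult_nonneg_nonneg) auto
        finally show ?thesis .
      qed
      then have "\<bar>T_tilde p q r s\<bar> \<le> \<bar>bracket p q r s\<bar> / m"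
        using q by (intro abs_T_tilde_le) (auto simp: m_def)
      also have "\<dots> \<le> (30000 * omega q) / m"
        using bd q om by (intro divide_right_mono bracket_le_smallest) (auto simp: m_def)
      also have "\<dots> = 30000 * 16" using q by (simp add: m_def)
      also have "\<dots> \<le> 30000 * 16 * 8^4 * t^4"
        using power_mono[of "1/8" t 4] False by (simp add: field_simps)
      also have "\<dots> \<le> K * t^4" using C by (intro mult_right_mono) (auto simp: K_def)
      also have "\<dots> \<le> K * ((norm s)\<^sup>2 * norm p)"
        using C RHS by (intro mult_left_mono) (auto simp: K_def)
      finally show ?thesis .
    qed
  qed
  moreover have "K > 0" using C by (simp add: K_def)
  ultimately show ?thesis by blast
qed

lemma T_tilde_le_ordered:
  "\<exists>C>0. \<forall>(p::'a::real_inner) q r s. resonant_ordered p q r s \<longrightarrow>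
     \<bar>T_tilde p q r s\<bar> \<le> C * ((norm s)\<^sup>2 * norm p)"
proof -
  obtain C where C: "C > 0" "\<forall>(p::'a::real_inner) q r s. resonant_ordered p q r s \<longrightarrow>
     omega p + omega r = 2 \<longrightarrow> \<bar>T_tilde p q r s\<bar> \<le> C * ((norm s)\<^sup>2 * norm p)"
    using T_tilde_le_normalized by (elim exE conjE)
  have "\<bar>T_tilde p q r s\<bar> \<le> C * ((norm s)\<^sup>2 * norm p)" if res: "resonant_ordered p q r s" for p q r s :: 'a
  proof -
    define w where "w = omega p + omega r"
    \<comment> \<open>\<open>omega\<close> scales with \<open>sqrt l\<close>, so this dilation
      achieves the normalization.\<close>
    define l where "l = (2 / w)\<^sup>2"
    have "w > 0" using res unfolding w_def resonant_ordered_def by linarith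
    then have l: "l > 0" "sqrt l * w = 2" by (simp_all add: l_def)
    have "resonant_ordered (l *\<^sub>R p) (l *\<^sub>R q) (l *\<^sub>R r) (l *\<^sub>R s)"
      using res l(1) unfolding resonant_ordered_def
      by (simp add: omega_scaleR flip: scaleR_add_right distrib_left)
    moreover have "omega (l *\<^sub>R p) + omega (l *\<^sub>R r) = 2"
      using l by (simp add: omega_scaleR w_def distrib_left)
    ultimately have "\<bar>l^3 * T_tilde p q r s\<bar> \<le> C * ((norm (l *\<^sub>R s))\<^sup>2 * norm (l *\<^sub>R p))"
      using C(2) T_tilde_scaleR[OF l(1), of p q r s] by metis
    then have "l^3 * \<bar>T_tilde p q r s\<bar> \<le> l^3 * (C * ((norm s)\<^sup>2 * norm p))"
      using l(1) by (simp add: abs_mult power_mult_distrib power2_eq_square power3_eq_cube mult_ac)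
    then show ?thesis using l(1) by simp
  qed
  with C(1) show ?thesis by blast
qed

section \<open>Symmetries and the reduction to ordered resonances\<close>

text \<open>Each swap permutes the channels. Momentum conservation identifies
  \<open>norm (q - r)\<close> with \<open>norm (p - s)\<close> and so on, and resonance identifies
  the frequency differences up to a sign, which the squares remove.\<close>

lemma T_tilde_symmetric:
  assumes "p + q = r + s" "omega p + omega q = omega r + omega s"
  shows T_tilde_swap_lower: "T_tilde q p r s = T_tilde p q r s"
    and T_tilde_swap_upper: "T_tilde p q s r = T_tilde p q r s"
    and T_tilde_swap_levels: "T_tilde r s p q = T_tilde p q r s"
proof -
  have n: "omega (q - r) = omega (p - s)" "omega (q - s) = omega (p - r)" "omega (r - p) = omega (p - r)"
    "omega (r + s) = omega (p + q)"
  proof -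
    have "p = r + s - q" using assms by (simp add: eq_diff_eq)
    then show "omega (q - r) = omega (p - s)" "omega (q - s) = omega (p - r)"
      "omega (r - p) = omega (p - r)" "omega (r + s) = omega (p + q)"
      by (simp_all add: omega_def norm_minus_commute)
  qed
  have d: "omega q - omega r = - (omega p - omega s)" "omega q - omega s = - (omega p - omega r)"
    "omega r - omega p = - (omega p - omega r)" "omega r - omega q = omega p - omega s"
    "omega s - omega p = - (omega p - omega s)" "omega r + omega s = omega p + omega q"
    using assms by auto
  have n2: "omega (r - q) = omega (p - s)" "omega (q + p) = omega (p + q)"
    using n by (simp_all add: omega_def norm_minus_commute add.commute)
  have d2: "omega q + omega p = omega p + omega q" by simp
  note f = f_plus_commute[of q p] f_plus_commute[of r p] f_plus_commute[of s p]
    f_plus_commute[of r q] f_plus_commute[of s q] f_plus_commute[of s r]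
    f_minus_commute[of q p] f_minus_commute[of r p] f_minus_commute[of s p]
    f_minus_commute[of r q] f_minus_commute[of s q] f_minus_commute[of s r]
  have w: "omega q * omega p * omega r * omega s = omega p * omega q * omega r * omega s"
    "omega p * omega q * omega s * omega r = omega p * omega q * omega r * omega s"
    "omega r * omega s * omega p * omega q = omega p * omega q * omega r * omega s"
    by (simp_all add: mult_ac)
  have "bracket q p r s = bracket p q r s"
    unfolding bracket_def n n2 d d2 power2_minus f by (simp add: algebra_simps)
  then show "T_tilde q p r s = T_tilde p q r s" by (simp add: T_tilde_eq w)
  have "bracket p q s r = bracket p q r s"
    unfolding bracket_def f by (simp add: algebra_simps)
  then show "T_tilde p q s r = T_tilde p q r s" by (simp add: T_tilde_eq w)
  have "bracket r s p q = bracket p q r s"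
    unfolding bracket_def n n2 d power2_minus f by (simp add: algebra_simps)
  then show "T_tilde r s p q = T_tilde p q r s" by (simp add: T_tilde_eq w)
qed

lemma T_tilde_le:
  "\<exists>C>0. \<forall>(p::'a::real_inner) q r s.
     p + q = r + s \<longrightarrow> omega p + omega q = omega r + omega s \<longrightarrow>
     p \<noteq> 0 \<longrightarrow> q \<noteq> 0 \<longrightarrow> r \<noteq> 0 \<longrightarrow> s \<noteq> 0 \<longrightarrow>
     (T_tilde p q r s)\<^sup>2 \<le> C
       * (Min {(norm p)\<^sup>2 + (norm q)\<^sup>2, (norm p)\<^sup>2 + (norm r)\<^sup>2, (norm p)\<^sup>2 + (norm s)\<^sup>2,
               (norm q)\<^sup>2 + (norm r)\<^sup>2, (norm q)\<^sup>2 + (norm s)\<^sup>2, (norm r)\<^sup>2 + (norm s)\<^sup>2})\<^sup>2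
       * ((norm p)\<^sup>2 + (norm q)\<^sup>2 + (norm r)\<^sup>2 + (norm s)\<^sup>2)"
proof -
  obtain C where C: "C > 0" "\<forall>(p::'a) q r s. resonant_ordered p q r s \<longrightarrow>
     \<bar>T_tilde p q r s\<bar> \<le> C * ((norm s)\<^sup>2 * norm p)"
    using T_tilde_le_ordered by (elim exE conjE)
  define B where "B p q r s \<longleftrightarrow> (T_tilde p q r s)\<^sup>2 \<le> C\<^sup>2
       * (Min {(norm p)\<^sup>2 + (norm q)\<^sup>2, (norm p)\<^sup>2 + (norm r)\<^sup>2, (norm p)\<^sup>2 + (norm s)\<^sup>2,
               (norm q)\<^sup>2 + (norm r)\<^sup>2, (norm q)\<^sup>2 + (norm s)\<^sup>2, (norm r)\<^sup>2 + (norm s)\<^sup>2})\<^sup>2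
       * ((norm p)\<^sup>2 + (norm q)\<^sup>2 + (norm r)\<^sup>2 + (norm s)\<^sup>2)" for p q r s :: 'a
  have ord: "B p q r s" if res: "resonant_ordered p q r s" for p q r s :: 'a
  proof -
    define m where "m = Min {(norm p)\<^sup>2 + (norm q)\<^sup>2, (norm p)\<^sup>2 + (norm r)\<^sup>2, (norm p)\<^sup>2 + (norm s)\<^sup>2,
               (norm q)\<^sup>2 + (norm r)\<^sup>2, (norm q)\<^sup>2 + (norm s)\<^sup>2, (norm r)\<^sup>2 + (norm s)\<^sup>2}"
    \<comment> \<open>Each pair of the four vectors contains \<open>p\<close>, \<open>r\<close> or
      \<open>s\<close>, none of them shorter than \<open>s\<close>, so the minimum is at least
      \<open>(norm s)\<^sup>2\<close>.\<close>
    have "norm s \<le> norm r" "norm s \<le> norm p"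
      using res unfolding resonant_ordered_def norm_eq_omega by (auto intro!: power_mono)
    then have "(norm s)\<^sup>2 \<le> (norm r)\<^sup>2" "(norm s)\<^sup>2 \<le> (norm p)\<^sup>2" by (auto intro: power_mono)
    then have m: "(norm s)\<^sup>2 \<le> m"
      unfolding m_def by (simp add: add_increasing add_increasing2)
    have "(T_tilde p q r s)\<^sup>2 \<le> (C * ((norm s)\<^sup>2 * norm p))\<^sup>2"
      using C(2) res power_mono[of "\<bar>T_tilde p q r s\<bar>" _ 2] by simp
    also have "\<dots> = C\<^sup>2 * ((norm s)\<^sup>2)\<^sup>2 * (norm p)\<^sup>2" by (simp add: power_mult_distrib)
    also have "\<dots> \<le> C\<^sup>2 * m\<^sup>2 * ((norm p)\<^sup>2 + (norm q)\<^sup>2 + (norm r)\<^sup>2 + (norm s)\<^sup>2)"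
      using m C(1) by (intro mult_mono power_mono) auto
    finally show ?thesis unfolding B_def m_def .
  qed
  have B_swap: "B q p r s = B p q r s" "B p q s r = B p q r s" "B r s p q = B p q r s"
    if "p + q = r + s" "omega p + omega q = omega r + omega s" for p q r s :: 'a
    unfolding B_def T_tilde_symmetric[OF that] by (simp_all only: insert_commute add_ac)
  have max: "B p q r s"
    if "p + q = r + s" "omega p + omega q = omega r + omega s"
      "0 < omega p" "0 < omega q" "0 < omega r" "0 < omega s"
      "omega q \<le> omega p" "omega r \<le> omega p" "omega s \<le> omega p" for p q r s :: 'a
  proof (cases "omega s \<le> omega r")
    case True
    then show ?thesis using that by (intro ord) (auto simp: resonant_ordered_def)
  next
    case False
    then have "B p q s r" using that by (intro ord) (auto simp: resonant_ordered_def add.commute)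
    then show ?thesis using B_swap(2)[OF that(1,2)] by simp
  qed
  have lower: "B p q r s"
    if "p + q = r + s" "omega p + omega q = omega r + omega s"
      "0 < omega p" "0 < omega q" "0 < omega r" "0 < omega s"
      "max (omega r) (omega s) \<le> max (omega p) (omega q)" for p q r s :: 'a
  proof (cases "omega q \<le> omega p")
    case True
    then show ?thesis using that by (intro max) auto
  next
    case False
    then have "B q p r s" using that by (intro max) (auto simp: add.commute)
    then show ?thesis using B_swap(1)[OF that(1,2)] by simp
  qed
  have all: "\<forall>p q r s. p + q = r + s \<longrightarrow> omega p + omega q = omega r + omega s \<longrightarrow>
      p \<noteq> 0 \<longrightarrow> q \<noteq> 0 \<longrightarrow> r \<noteq> 0 \<longrightarrow> s \<noteq> 0 \<longrightarrow> B p q r s"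
  proof (intro allI impI)
    fix p q r s :: 'a
    assume *: "p + q = r + s" "omega p + omega q = omega r + omega s"
      and nz: "p \<noteq> 0" "q \<noteq> 0" "r \<noteq> 0" "s \<noteq> 0"
    note pos = nz[THEN omega_pos]
    show "B p q r s"
    proof (cases "max (omega r) (omega s) \<le> max (omega p) (omega q)")
      case True
      then show ?thesis using * pos by (intro lower)
    next
      case False
      then have "max (omega p) (omega q) \<le> max (omega r) (omega s)"
        by (simp only: not_le less_imp_le)
      then have "B r s p q" using *[symmetric] pos by (intro lower)
      then show ?thesis using B_swap(3)[OF *] by simp
    qed
  qed
  have "C\<^sup>2 > 0" using C by simp
  then show ?thesis
    by (intro exI[of _ "C\<^sup>2"] conjI all[unfolded B_def])
qed

theorem proposition2p1:
  assumes "CARD('n::finite) \<ge> 2"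
  shows "\<exists>C_Q::real. C_Q > 0 \<and>
    (\<forall>k :: nat \<Rightarrow> real ^ 'n.
      resonant (k 0) (k 1) (k 2) (k 3) \<longrightarrow>
      T_sym_defined (k 1) (k 0) (k 2) (k 3) \<longrightarrow>
      collision_kernel (k 0) (k 1) (k 2) (k 3)
        \<le> C_Q * (Min {(norm (k j))\<^sup>2 + (norm (k l))\<^sup>2 | j l. j < l \<and> l \<le> 3})\<^sup>2
              * (\<Sum>j=0..3. (norm (k j))\<^sup>2))"
proof -
  obtain C where C: "C > 0" "\<forall>(p::real^'n) q r s.
     p + q = r + s \<longrightarrow> omega p + omega q = omega r + omega s \<longrightarrow>
     p \<noteq> 0 \<longrightarrow> q \<noteq> 0 \<longrightarrow> r \<noteq> 0 \<longrightarrow> s \<noteq> 0 \<longrightarrow>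
     (T_tilde p q r s)\<^sup>2 \<le> C
       * (Min {(norm p)\<^sup>2 + (norm q)\<^sup>2, (norm p)\<^sup>2 + (norm r)\<^sup>2, (norm p)\<^sup>2 + (norm s)\<^sup>2,
               (norm q)\<^sup>2 + (norm r)\<^sup>2, (norm q)\<^sup>2 + (norm s)\<^sup>2, (norm r)\<^sup>2 + (norm s)\<^sup>2})\<^sup>2
       * ((norm p)\<^sup>2 + (norm q)\<^sup>2 + (norm r)\<^sup>2 + (norm s)\<^sup>2)"
    using T_tilde_le by (elim exE conjE)
  have "collision_kernel (k 0) (k 1) (k 2) (k 3)
        \<le> C * (Min {(norm (k j))\<^sup>2 + (norm (k l))\<^sup>2 | j l. j < l \<and> l \<le> 3})\<^sup>2
              * (\<Sum>j=0..3. (norm (k j))\<^sup>2)"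
    if res: "resonant (k 0) (k 1) (k 2) (k 3)" and dfd: "T_sym_defined (k 1) (k 0) (k 2) (k 3)"
    for k :: "nat \<Rightarrow> real ^ 'n"
  proof -
    have r: "k 0 + k 1 = k 2 + k 3" "omega (k 0) + omega (k 1) = omega (k 2) + omega (k 3)"
      using res by (auto simp: resonant_def omega_def)
    then have r': "k 2 + k 3 = k 0 + k 1" "omega (k 2) + omega (k 3) = omega (k 0) + omega (k 1)"
      by simp_all
    \<comment> \<open>On the resonant manifold all four summands of the symmetrization coincide,
      which cancels the factor 1/4.\<close>
    have T: "T_sym (k 1) (k 0) (k 2) (k 3) = T_tilde (k 0) (k 1) (k 2) (k 3)"
    proof -
      have "T_tilde (k 2) (k 3) (k 1) (k 0) = T_tilde (k 0) (k 1) (k 2) (k 3)"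
        using T_tilde_swap_levels[OF r] T_tilde_swap_upper[OF r'] by simp
      moreover have "T_tilde (k 3) (k 2) (k 1) (k 0) = T_tilde (k 2) (k 3) (k 1) (k 0)"
        using r' by (intro T_tilde_swap_lower) (simp_all add: add.commute)
      ultimately show ?thesis
        unfolding T_sym_def using T_tilde_swap_lower[OF r] by simp
    qed
    have pairs: "j < l \<and> l \<le> 3 \<longleftrightarrow> j = 0 \<and> l = 1 \<or> j = 0 \<and> l = 2 \<or> j = 0 \<and> l = 3
        \<or> j = 1 \<and> l = 2 \<or> j = 1 \<and> l = 3 \<or> j = 2 \<and> l = 3" for j l :: nat
      by presburger
    have M: "{(norm (k j))\<^sup>2 + (norm (k l))\<^sup>2 | j l. j < l \<and> l \<le> 3} =
      {(norm (k 0))\<^sup>2 + (norm (k 1))\<^sup>2, (norm (k 0))\<^sup>2 + (norm (k 2))\<^sup>2, (norm (k 0))\<^sup>2 + (norm (k 3))\<^sup>2,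
       (norm (k 1))\<^sup>2 + (norm (k 2))\<^sup>2, (norm (k 1))\<^sup>2 + (norm (k 3))\<^sup>2, (norm (k 2))\<^sup>2 + (norm (k 3))\<^sup>2}"
      unfolding pairs by blast
    have S: "(\<Sum>j=0..3. (norm (k j))\<^sup>2)
        = (norm (k 0))\<^sup>2 + (norm (k 1))\<^sup>2 + (norm (k 2))\<^sup>2 + (norm (k 3))\<^sup>2"
      by (simp add: eval_nat_numeral)
    have "k 0 \<noteq> 0" "k 1 \<noteq> 0" "k 2 \<noteq> 0" "k 3 \<noteq> 0"
      using dfd unfolding T_sym_defined_def T_tilde_defined_def by simp_all
    then show ?thesis
      unfolding collision_kernel_def T M S power2_abs by (rule C(2)[rule_format, OF r])
  qed
  with C(1) show ?thesis by blast
qed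

end
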